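(* Consider the two ternary Leibniz algebras over $\mathbb{C}$ with basis $\{e_1,e_2\}$ (brackets of basis vectors not listed are zero): $\mathcal{L}_1$: $[e_1,e_1,e_1]=e_2$; and $\mathcal{L}_2$: $[e_1,e_2,e_2]=e_1,\ [e_2,e_2,e_2]=e_1$. The Nijenhuis operators $N$ on these algebras are described as follows (with $N_{ij}\in\mathbb{C}$ arbitrary parameters). \begin{itemize} \item The Nijenhuis operators on $\mathcal{L}_1$ are exactly the linear maps whose matrix has the form $$\begin{pmatrix}N_{11}&0\\ N_{21}&N_{11}\end{pmatrix}.$$ \item The Nijenhuis operators on $\mathcal{L}_2$ are exactly the linear maps whose matrix has one of the forms $$\begin{pmatrix}N_{11}&N_{12}\\ 0&N_{11}\end{pmatrix},\qquad \begin{pmatrix}N_{11}&N_{11}-N_{22}\\ 0&N_{22}\end{pmatrix}.$$ \end{itemize}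
   Context: A ternary Leibniz algebra is a vector space $L$ with a trilinear bracket satisfying $[[x,y,z],t,u]=[x,y,[z,t,u]]+[x,[y,t,u],z]+[[x,t,u],y,z]$ for all $x,y,z,t,u\in L$. A Nijenhuis operator on it is a linear map $N:L\to L$ with, for all $x,y,z\in L$, \begin{align*} [N(x),N(y),N(z)]&=N\big([N(x),N(y),z]+[N(x),y,N(z)]+[x,N(y),N(z)]\big)\\ &\quad-N^2\big([N(x),y,z]+[x,N(y),z]+[x,y,N(z)]\big)+N^3([x,y,z]). \end{align*} The matrix $(N_{ij})$ of $N$ in the basis $\{e_i\}$ is defined by $N(e_i)=\sum_jN_{ji}e_j$ (columns are the images of basis vectors). *)

theory Defs
  imports "HOL-Analysis.Analysis"
begin

locale ternary_leibniz_algebra = vector_space smul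
  for smul :: "'k::field \<Rightarrow> 'v::ab_group_add \<Rightarrow> 'v" +
  fixes bracket :: "'v \<Rightarrow> 'v \<Rightarrow> 'v \<Rightarrow> 'v"
  assumes linear_bracket_1: "Vector_Spaces.linear smul smul (\<lambda>x. bracket x y z)"
    and linear_bracket_2: "Vector_Spaces.linear smul smul (\<lambda>y. bracket x y z)"
    and linear_bracket_3: "Vector_Spaces.linear smul smul (\<lambda>z. bracket x y z)"
    and leibniz_identity:
      "bracket (bracket x y z) t u =
         bracket x y (bracket z t u) + bracket x (bracket y t u) z + bracket (bracket x t u) y z"

locale nijenhuis_operator = ternary_leibniz_algebra smul bracket
  for smul :: "'k::field \<Rightarrow> 'v::ab_group_add \<Rightarrow> 'v" and bracket +
  fixes N :: "'v \<Rightarrow> 'v"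
  assumes linear_operator: "Vector_Spaces.linear smul smul N"
    and nijenhuis_identity:
      "bracket (N x) (N y) (N z) =
         N (bracket (N x) (N y) z + bracket (N x) y (N z) + bracket x (N y) (N z))
         - N (N (bracket (N x) y z + bracket x (N y) z + bracket x y (N z)))
         + N (N (N (bracket x y z)))"

locale indexed_basis = vector_space smul
  for smul :: "'k::field \<Rightarrow> 'v::ab_group_add \<Rightarrow> 'v" +
  fixes e :: "'n::finite \<Rightarrow> 'v"
  assumes inj_basis: "inj e"
    and independent_basis: "independent (range e)"
    and span_basis: "span (range e) = UNIV"

definition coord ::
    "('k::field \<Rightarrow> 'v::ab_group_add \<Rightarrow> 'v) \<Rightarrow> ('n::finite \<Rightarrow> 'v) \<Rightarrow> 'v \<Rightarrow> 'n \<Rightarrow> 'k" where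
  "coord smul e x i = module.representation smul (range e) x (e i)"

text \<open>Columns are the images of the basis vectors, \<open>N (e i) = (\<Sum>j. N\<^sub>j\<^sub>i e j)\<close>, as for the
  library constant \<^const>\<open>matrix\<close>, which is restricted to the standard basis.\<close>

definition matrix_wrt ::
    "('k::field \<Rightarrow> 'v::ab_group_add \<Rightarrow> 'v) \<Rightarrow> ('n::finite \<Rightarrow> 'v) \<Rightarrow> ('v \<Rightarrow> 'v) \<Rightarrow> 'k^'n^'n" where
  "matrix_wrt smul e N = (\<chi> i j. coord smul e (N (e j)) i)"

text \<open>The trilinear map taking the value \<open>c i j k\<close> at \<open>(e i, e j, e k)\<close>.\<close>

definition trilinear_extension ::
    "('k::field \<Rightarrow> 'v::ab_group_add \<Rightarrow> 'v) \<Rightarrow> ('n::finite \<Rightarrow> 'v) \<Rightarrow> ('n \<Rightarrow> 'n \<Rightarrow> 'n \<Rightarrow> 'v)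
      \<Rightarrow> 'v \<Rightarrow> 'v \<Rightarrow> 'v \<Rightarrow> 'v" where
  "trilinear_extension smul e c x y z =
     (\<Sum>i\<in>UNIV. \<Sum>j\<in>UNIV. \<Sum>k\<in>UNIV.
        smul (coord smul e x i * coord smul e y j * coord smul e z k) (c i j k))"

context indexed_basis
begin

lemma coord_basis: "coord smul e (e i) j = (if i = j then 1 else 0)"
  using inj_basis representation_basis[OF independent_basis, of "e i"]
  by (auto simp: coord_def inj_eq)

lemma sum_coord: "(\<Sum>i\<in>UNIV. smul (coord smul e x i) (e i)) = x"
proof -
  have "(\<Sum>i\<in>UNIV. smul (coord smul e x i) (e i))
      = (\<Sum>b\<in>range e. smul (representation (range e) x b) b)"
    unfolding coord_def by (subst sum.reindex[OF inj_basis]) simp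
  also have "\<dots> = x"
    by (rule sum_representation_eq) (simp_all add: independent_basis span_basis)
  finally show ?thesis .
qed

lemma apply_basis_matrix_wrt: "N (e i) = (\<Sum>j\<in>UNIV. smul (matrix_wrt smul e N $ j $ i) (e j))"
  by (simp add: matrix_wrt_def sum_coord)

lemma linear_coord: "Vector_Spaces.linear smul (*) (\<lambda>x. coord smul e x i)"
  unfolding Vector_Spaces.linear_iff_module_hom coord_def
  by unfold_locales
    (simp_all add: algebra_simps representation_add[OF independent_basis]
      representation_scale[OF independent_basis] span_basis)

lemma trilinear_extension_basis: "trilinear_extension smul e c (e i) (e j) (e k) = c i j k"
proof -
  have eq: "smul (coord smul e (e i) p * coord smul e (e j) q * coord smul e (e k) r) (c p q r)
      = (if k = r then if j = q then if i = p then c p q r else 0 else 0 else 0)" for p q r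
    by (simp add: coord_basis)
  show ?thesis
    unfolding trilinear_extension_def eq by simp
qed

end

text \<open>In the index type \<^typ>\<open>2\<close> the numeral \<open>2\<close> is the second of the two elements (equal to \<open>0\<close>).\<close>

definition L1_bracket ::
    "('k::field \<Rightarrow> 'v::ab_group_add \<Rightarrow> 'v) \<Rightarrow> (2 \<Rightarrow> 'v) \<Rightarrow> 'v \<Rightarrow> 'v \<Rightarrow> 'v \<Rightarrow> 'v" where
  "L1_bracket smul e = trilinear_extension smul e
     (\<lambda>i j k. if (i, j, k) = (1, 1, 1) then e 2 else 0)"

definition L2_bracket ::
    "('k::field \<Rightarrow> 'v::ab_group_add \<Rightarrow> 'v) \<Rightarrow> (2 \<Rightarrow> 'v) \<Rightarrow> 'v \<Rightarrow> 'v \<Rightarrow> 'v \<Rightarrow> 'v" where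
  "L2_bracket smul e = trilinear_extension smul e
     (\<lambda>i j k. if (i, j, k) = (1, 2, 2) then e 1
              else if (i, j, k) = (2, 2, 2) then e 1 else 0)"

end

theory Submission
  imports Defs
begin

text \<open>
  Both brackets have rank one: each is of the form
  \<open>[x, y, z] = f x * g y * g z \<cdot> w\<close> with linear functionals \<open>f, g\<close> and a vector \<open>w\<close> that spans the
  kernel of \<open>g\<close>. For \<open>\<L>\<^sub>1\<close> both functionals are the first coordinate and \<open>w = e\<^sub>2\<close>; for \<open>\<L>\<^sub>2\<close> the
  functional \<open>f\<close> is the sum of the coordinates, \<open>g\<close> is the second coordinate and \<open>w = e\<^sub>1\<close>. The
  Leibniz identity follows from \<open>g w = 0\<close>: two terms on the right vanish, and the
  remaining one equals the left-hand side by commutativity of the field.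

  If \<open>N w = \<mu> w\<close>, then \<open>N\<close> acts on all bracket values as multiplication by \<open>\<mu>\<close>. The difference of
  the two sides of the Nijenhuis identity is then the expansion of the product
  \<open>(f (N x) - \<mu> f x) (g (N y) - \<mu> g y) (g (N z) - \<mu> g z)\<close>, times \<open>w\<close>
  (\<open>nijenhuis_identity_iff\<close>). A product of functions of independent variables vanishes identically
  only if one factor does, so the identity says that \<open>f \<circ> N = \<mu> f\<close> or \<open>g \<circ> N = \<mu> g\<close>. The
  Nijenhuis identity itself, at \<open>(w, w, w)\<close>, forces \<open>w\<close> to be an eigenvector of \<open>N\<close>
  (\<open>eigenvector_if_nijenhuis\<close>). This gives the criterion \<open>nijenhuis_operator_iff\<close>, valid over
  every field. Checked on basis vectors, its conditions are linear equations
  between matrix entries, and these describe the listed matrix shapes. For \<open>\<L>\<^sub>2\<close> the two shapes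
  correspond to the two alternatives: \<open>g \<circ> N = \<mu> g\<close> gives equal diagonal entries, and
  \<open>f \<circ> N = \<mu> f\<close> gives equal column sums.
\<close>

section \<open>Brackets of rank one\<close>

text \<open>
  In dimension two \<open>ker_f\<close> amounts to \<open>f \<noteq> 0\<close>. It excludes the zero bracket, for
  which every linear map is a Nijenhuis operator, whether or not \<open>w\<close> is an eigenvector.
\<close>

locale rank_one_bracket = vector_space smul
  for smul :: "'k::field \<Rightarrow> 'v::ab_group_add \<Rightarrow> 'v" +
  fixes f g :: "'v \<Rightarrow> 'k" and w :: 'v
  assumes linear_f: "Vector_Spaces.linear smul (*) f"
    and linear_g: "Vector_Spaces.linear smul (*) g"
    and w_nonzero: "w \<noteq> 0"
    and ker_g: "g v = 0 \<longleftrightarrow> (\<exists>\<mu>. v = smul \<mu> w)"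
    and ker_f: "f w = 0 \<Longrightarrow> f v = 0 \<Longrightarrow> g v = 0"
begin

definition bracket :: "'v \<Rightarrow> 'v \<Rightarrow> 'v \<Rightarrow> 'v" where
  "bracket x y z = smul (f x * g y * g z) w"

lemma functional_simps:
  "f (x + y) = f x + f y" "f (smul c x) = c * f x"
  "g (x + y) = g x + g y" "g (smul c x) = c * g x"
  using linear_f linear_g by (simp_all add: Vector_Spaces.linear_iff)

lemma g_w: "g w = 0"
  unfolding ker_g by (rule exI[of _ 1]) simp

lemma ternary_leibniz: "ternary_leibniz_algebra smul bracket"
proof -
  have "Vector_Spaces.linear smul smul (\<lambda>x. bracket x y z)"
    and "Vector_Spaces.linear smul smul (\<lambda>x. bracket y x z)"
    and "Vector_Spaces.linear smul smul (\<lambda>x. bracket y z x)" for y z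
    by (simp_all add: Vector_Spaces.linear_iff bracket_def vector_space_axioms functional_simps
        algebra_simps)
  then show ?thesis
    unfolding ternary_leibniz_algebra_def ternary_leibniz_algebra_axioms_def
    by (simp add: vector_space_axioms bracket_def g_w functional_simps mult_ac)
qed

text \<open>
  Each application of \<open>N\<close> to a bracket contributes a factor \<open>\<mu>\<close>, so the term with \<open>k\<close> undecorated
  arguments carries \<open>\<mu>\<^sup>k\<close>, with alternating signs: this is the expansion of a product of
  three differences.
\<close>

lemma nijenhuis_identity_iff:
  assumes N: "Vector_Spaces.linear smul smul N" and eigen: "N w = smul \<mu> w"
  shows "bracket (N x) (N y) (N z) =
         N (bracket (N x) (N y) z + bracket (N x) y (N z) + bracket x (N y) (N z))
         - N (N (bracket (N x) y z + bracket x (N y) z + bracket x y (N z)))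
         + N (N (N (bracket x y z))) \<longleftrightarrow>
    (f (N x) - \<mu> * f x) * (g (N y) - \<mu> * g y) * (g (N z) - \<mu> * g z) = 0"
    (is "?l = ?r \<longleftrightarrow> ?p = 0")
proof -
  have N_smul_w: "N (smul c w) = smul (c * \<mu>) w" for c
    using N by (simp add: Vector_Spaces.linear_iff eigen)
  have "?l - ?r = smul ?p w"
    unfolding bracket_def
    by (simp only: N_smul_w flip: scale_left_distrib scale_left_diff_distrib)
       (rule arg_cong[of _ _ "\<lambda>c. smul c w"], simp add: algebra_simps)
  then have "?l = ?r \<longleftrightarrow> smul ?p w = 0"
    using right_minus_eq[of ?l ?r] by argo
  then show ?thesis
    using w_nonzero by simp
qed

text \<open>
  At \<open>(w, w, w)\<close> only the terms without an undecorated argument in the second or third position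
  survive, because \<open>g w = 0\<close>. They relate \<open>w\<close> and \<open>N w\<close> linearly; if \<open>N w\<close> lies off the line of \<open>w\<close>,
  both coefficients must vanish, so that \<open>f\<close> kills both vectors, against \<open>ker_f\<close>.
\<close>

lemma eigenvector_if_nijenhuis:
  assumes "nijenhuis_operator smul bracket N"
  shows "\<exists>\<mu>. N w = smul \<mu> w"
proof (rule ccontr)
  interpret nijenhuis_operator smul bracket N
    by fact
  have N: "N (x + y) = N x + N y" "N (smul c x) = smul c (N x)" for x y c
    using linear_operator by (simp_all add: Vector_Spaces.linear_iff)
  have "N 0 = 0"
    using N(2)[of 0 0] by simp
  assume "\<nexists>\<mu>. N w = smul \<mu> w"
  then have nz: "g (N w) \<noteq> 0"
    by (simp add: ker_g)
  have eq: "smul (f (N w) * g (N w) * g (N w)) w = smul (f w * g (N w) * g (N w)) (N w)"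
    using nijenhuis_identity[of w w w]
    by (simp add: bracket_def g_w N \<open>N 0 = 0\<close>)
  from arg_cong[OF eq, of g] nz have "f w = 0"
    by (simp add: functional_simps g_w)
  with eq w_nonzero nz have "f (N w) = 0"
    by simp
  with \<open>f w = 0\<close> ker_f nz show False
    by blast
qed

theorem nijenhuis_operator_iff:
  "nijenhuis_operator smul bracket N \<longleftrightarrow>
    Vector_Spaces.linear smul smul N \<and>
    (\<exists>\<mu>. N w = smul \<mu> w \<and> ((\<forall>x. f (N x) = \<mu> * f x) \<or> (\<forall>x. g (N x) = \<mu> * g x)))"
proof (intro iffI conjI; (elim conjE exE)?)
  assume nij: "nijenhuis_operator smul bracket N"
  then interpret nijenhuis_operator smul bracket N .
  show "Vector_Spaces.linear smul smul N"
    by (fact linear_operator)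
  obtain \<mu> where \<mu>: "N w = smul \<mu> w"
    using eigenvector_if_nijenhuis[OF nij] by blast
  \<comment> \<open>Repeating \<open>y\<close> turns the last two factors into a square, which leaves two independent variables.\<close>
  have "(f (N x) - \<mu> * f x) * (g (N y) - \<mu> * g y) * (g (N y) - \<mu> * g y) = 0" for x y
    using nijenhuis_identity[of x y y]
    unfolding nijenhuis_identity_iff[OF linear_operator \<mu>] .
  then have "f (N x) = \<mu> * f x \<or> g (N y) = \<mu> * g y" for x y
    by simp
  then show "\<exists>\<mu>. N w = smul \<mu> w \<and> ((\<forall>x. f (N x) = \<mu> * f x) \<or> (\<forall>x. g (N x) = \<mu> * g x))"
    using \<mu> by blast
next
  fix \<mu>
  assume N: "Vector_Spaces.linear smul smul N" and \<mu>: "N w = smul \<mu> w"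
    and "(\<forall>x. f (N x) = \<mu> * f x) \<or> (\<forall>x. g (N x) = \<mu> * g x)"
  then have "(f (N x) - \<mu> * f x) * (g (N y) - \<mu> * g y) * (g (N z) - \<mu> * g z) = 0" for x y z
    by auto
  then show "nijenhuis_operator smul bracket N"
    unfolding nijenhuis_operator_def nijenhuis_operator_axioms_def
      nijenhuis_identity_iff[OF N \<mu>]
    using N ternary_leibniz by blast
qed

end

section \<open>The two plane algebras\<close>

locale plane_basis = indexed_basis smul e
  for smul :: "'k::field \<Rightarrow> 'v::ab_group_add \<Rightarrow> 'v" and e :: "2 \<Rightarrow> 'v"
begin

abbreviation cd :: "2 \<Rightarrow> 'v \<Rightarrow> 'k" where "cd i x \<equiv> coord smul e x i"

lemma cd_simps: "cd i (x + y) = cd i x + cd i y" "cd i (smul c x) = c * cd i x"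
  using linear_coord by (auto simp: Vector_Spaces.linear_iff)

lemma eq_scaled_basis_iff: "v = smul \<mu> (e i) \<longleftrightarrow> (\<forall>j. cd j v = (if j = i then \<mu> else 0))"
proof
  assume "\<forall>j. cd j v = (if j = i then \<mu> else 0)"
  then have "v = (\<Sum>j\<in>UNIV. smul (if j = i then \<mu> else 0) (e j))"
    using sum_coord[of v] by simp
  also have "\<dots> = (\<Sum>j\<in>UNIV. if j = i then smul \<mu> (e j) else 0)"
    by (intro sum.cong) auto
  finally show "v = smul \<mu> (e i)"
    by simp
qed (simp add: cd_simps coord_basis)

lemma basis_nonzero: "e i \<noteq> 0"
  using independent_basis dependent_zero[of "range e"] by force

lemma functional_intertwines_iff:
  assumes f: "Vector_Spaces.linear smul (*) f" and N: "Vector_Spaces.linear smul smul N"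
  shows "(\<forall>x. f (N x) = \<mu> * f x) \<longleftrightarrow> f (N (e 1)) = \<mu> * f (e 1) \<and> f (N (e 2)) = \<mu> * f (e 2)"
proof safe
  fix x
  assume a: "f (N (e 1)) = \<mu> * f (e 1)" "f (N (e 2)) = \<mu> * f (e 2)"
  have x: "x = smul (cd 1 x) (e 1) + smul (cd 2 x) (e 2)"
    using sum_coord[of x] by (simp add: sum_2)
  have lin: "f (u + v) = f u + f v" "f (smul c v) = c * f v"
    "N (u + v) = N u + N v" "N (smul c v) = smul c (N v)" for u v c
    using f N by (simp_all add: Vector_Spaces.linear_iff)
  have "f (N x) = cd 1 x * f (N (e 1)) + cd 2 x * f (N (e 2))"
    by (subst x) (simp only: lin)
  also have "\<dots> = \<mu> * (cd 1 x * f (e 1) + cd 2 x * f (e 2))"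
    by (simp add: a algebra_simps)
  also have "\<dots> = \<mu> * f x"
    by (subst (3) x) (simp only: lin)
  finally show "f (N x) = \<mu> * f x" .
qed auto

lemma linear_cd_sum: "Vector_Spaces.linear smul (*) (\<lambda>x. cd 1 x + cd 2 x)"
  using linear_coord[of 1] linear_coord[of 2]
  by (simp add: Vector_Spaces.linear_iff algebra_simps)

sublocale L1: rank_one_bracket smul "cd 1" "cd 1" "e 2"
  by unfold_locales
    (auto simp: cd_simps basis_nonzero eq_scaled_basis_iff forall_2)

sublocale L2: rank_one_bracket smul "\<lambda>x. cd 1 x + cd 2 x" "cd 2" "e 1"
  by unfold_locales
    (auto simp: cd_simps algebra_simps basis_nonzero eq_scaled_basis_iff forall_2 coord_basis)

lemma L1_bracket_rank_one: "L1_bracket smul e = L1.bracket"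
  by (intro ext)
    (simp add: L1_bracket_def trilinear_extension_def L1.bracket_def sum_2)

lemma L2_bracket_rank_one: "L2_bracket smul e = L2.bracket"
  by (intro ext)
    (simp add: L2_bracket_def trilinear_extension_def L2.bracket_def sum_2 algebra_simps)

lemma nijenhuis_L1_iff:
  "nijenhuis_operator smul (L1_bracket smul e) N \<longleftrightarrow> Vector_Spaces.linear smul smul N \<and>
    (\<exists>N11 N21. matrix_wrt smul e N = vector [vector [N11, 0], vector [N21, N11]])"
  unfolding L1_bracket_rank_one L1.nijenhuis_operator_iff
  by (intro conj_cong refl)
     (auto simp: functional_intertwines_iff[OF linear_coord] eq_scaled_basis_iff coord_basis
       vec_eq_iff forall_2 vector_2 matrix_wrt_def)

lemma nijenhuis_L2_iff:
  "nijenhuis_operator smul (L2_bracket smul e) N \<longleftrightarrow> Vector_Spaces.linear smul smul N \<and>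
    ((\<exists>N11 N12. matrix_wrt smul e N = vector [vector [N11, N12], vector [0, N11]]) \<or>
     (\<exists>N11 N22. matrix_wrt smul e N = vector [vector [N11, N11 - N22], vector [0, N22]]))"
  unfolding L2_bracket_rank_one L2.nijenhuis_operator_iff
  by (intro conj_cong refl)
     (auto simp: functional_intertwines_iff[OF linear_coord]
       functional_intertwines_iff[OF linear_cd_sum] eq_scaled_basis_iff coord_basis
       vec_eq_iff forall_2 vector_2 matrix_wrt_def eq_diff_eq)

end

theorem proposition4p13:
  fixes smul :: "complex \<Rightarrow> 'v::ab_group_add \<Rightarrow> 'v" and e :: "2 \<Rightarrow> 'v"
  assumes "indexed_basis smul e"
  shows "ternary_leibniz_algebra smul (L1_bracket smul e) \<and>
    ternary_leibniz_algebra smul (L2_bracket smul e) \<and>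
    {N. nijenhuis_operator smul (L1_bracket smul e) N} =
      {N. Vector_Spaces.linear smul smul N \<and>
        (\<exists>N11 N21. matrix_wrt smul e N = vector [vector [N11, 0], vector [N21, N11]])} \<and>
    {N. nijenhuis_operator smul (L2_bracket smul e) N} =
      {N. Vector_Spaces.linear smul smul N \<and>
        ((\<exists>N11 N12. matrix_wrt smul e N = vector [vector [N11, N12], vector [0, N11]]) \<or>
         (\<exists>N11 N22. matrix_wrt smul e N = vector [vector [N11, N11 - N22], vector [0, N22]]))}"
proof -
  interpret plane_basis smul e
    using assms by (rule plane_basis.intro)
  show ?thesis
    using L1.ternary_leibniz L2.ternary_leibniz nijenhuis_L1_iff nijenhuis_L2_iff
    unfolding L1_bracket_rank_one L2_bracket_rank_one by blast
qed

end
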